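(* Let $G$ be a group acting on $\mathcal{X}^n$, and let $\{\mathbf{P}_g\}_{g\in G}$ and $\{\mathbf{Q}_g\}_{g\in G}$ be two models on $\mathcal{X}^n$ that are invariant and have densities with respect to a common measure $\mu$ on $\mathcal{X}^n$ that is relatively left invariant with some multiplier $\chi$, all densities having a single common support. Suppose that for each $g\in G$ there exists $h\in G$ such that $\mathrm{KL}(\mathbf{Q}_g,\mathbf{P}_h)$ is finite. Then the map $$g\mapsto\sup_{T_n\ \text{e-statistic}}\mathbf{E}^{\mathbf{Q}}_g[\ln T_n]$$ is constant on $G$. Consequently, any maximizer over e-statistics of $$T_n\mapsto\inf_{g\in G}\mathbf{E}^{\mathbf{Q}}_g[\ln T_n]$$ also maximizes over e-statistics $$T_n\mapsto\inf_{g\in G}\left\{\mathbf{E}^{\mathbf{Q}}_g[\ln T_n]-\sup_{T_n'\ \text{e-statistic}}\mathbf{E}^{\mathbf{Q}}_g[\ln T_n']\right\};$$ that is, an e-statistic is GROW if and only if it is relatively GROW for testing $\mathcal{H}_0:X^n\sim\mathbf{P}_g,\ g\in G$ versus $\mathcal{H}_1:X^n\sim\mathbf{Q}_g,\ g\in G$.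
   Context: $G$ is a topological group acting on the topological space $\mathcal{X}^n$, both equipped with their Borel $\sigma$-algebras; the action on $\mathcal{X}^n$ is the componentwise extension of an action on $\mathcal{X}$. $X^n$ is the data, with values in $\mathcal{X}^n$; $\mathbf{E}^{\mathbf{P}}_g,\mathbf{E}^{\mathbf{Q}}_g$ are the expectations when $X^n$ has distribution $\mathbf{P}_g$, $\mathbf{Q}_g$. Invariance: $\{\mathbf{P}_g\}_{g\in G}$ is invariant if $\mathbf{P}_{hg}\{X^n\in hB\}=\mathbf{P}_g\{X^n\in B\}$ for all $g,h\in G$ and measurable $B\subseteq\mathcal{X}^n$; similarly for $\{\mathbf{Q}_g\}$. Relatively left invariant with multiplier $\chi$: $\mu\{gB\}=\chi(g)\mu\{B\}$ for any measurable $B\subseteq\mathcal{X}^n$ and $g\in G$. Single common support: the densities are positive on one and the same set. $\mathrm{KL}(\mathbf{Q},\mathbf{P})=\mathbf{E}^{\mathbf{Q}}[\ln(\mathrm{d}\mathbf{Q}/\mathrm{d}\mathbf{P})]$. E-statistic: a statistic (measurable function of the data) $T_n=t_n(X^n)\ge 0$ with $\sup_{g\in G}\mathbf{E}^{\mathbf{P}}_g[T_n]\le 1$. GROW: maximizes the first displayed objective ($\inf_g\mathbf{E}^{\mathbf{Q}}_g[\ln T_n]$) over all e-statistics. Relatively GROW: maximizes the second displayed objective over all e-statistics. *)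

theory Defs
  imports "HOL-Probability.Probability" "HOL-Algebra.Group_Action"
begin

definition topological_group :: "('g, 'm) monoid_scheme \<Rightarrow> 'g topology \<Rightarrow> bool" where
  "topological_group G \<tau> \<longleftrightarrow>
     group G \<and> topspace \<tau> = carrier G \<and>
     continuous_map (prod_topology \<tau> \<tau>) \<tau> (\<lambda>(g, h). g \<otimes>\<^bsub>G\<^esub> h) \<and>
     continuous_map \<tau> \<tau> (\<lambda>g. inv\<^bsub>G\<^esub> g)"

definition componentwise :: "('g \<Rightarrow> 'x \<Rightarrow> 'x) \<Rightarrow> 'g \<Rightarrow> 'x ^ 'n \<Rightarrow> 'x ^ 'n" where
  "componentwise a g x = (\<chi> i. a g (x $ i))"

definition relatively_left_invariant ::
  "('g, 'm) monoid_scheme \<Rightarrow> ('g \<Rightarrow> 'y \<Rightarrow> 'y) \<Rightarrow> ('g \<Rightarrow> real) \<Rightarrow> 'y measure \<Rightarrow> bool" where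
  "relatively_left_invariant G act chi M \<longleftrightarrow>
     (\<forall>g\<in>carrier G. 0 < chi g \<and>
        (\<forall>B\<in>sets M. emeasure M (act g ` B) = ennreal (chi g) * emeasure M B))"

definition invariant_model ::
  "('g, 'm) monoid_scheme \<Rightarrow> ('g \<Rightarrow> 'y \<Rightarrow> 'y) \<Rightarrow> ('g \<Rightarrow> 'y::topological_space measure) \<Rightarrow> bool" where
  "invariant_model G act M \<longleftrightarrow>
     (\<forall>g\<in>carrier G. \<forall>h\<in>carrier G. \<forall>B\<in>sets borel.
        emeasure (M (h \<otimes>\<^bsub>G\<^esub> g)) (act h ` B) = emeasure (M g) B)"

definition eln :: "ennreal \<Rightarrow> ereal" where
  "eln t = (if t = 0 then -\<infinity> else if t = \<infinity> then \<infinity> else ereal (ln (enn2real t)))"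

(* Difference of the integrals of the positive and the negative part.  If both are infinite the
   value is the junk value \<infinity> - \<infinity> = \<infinity>.  This does not happen for
   KL(Q, P) (the negative part is integrable), nor for the expectation of ln T under Q when
   KL(Q, P) is finite and T has expectation at most 1 under P (the positive part is integrable). *)
definition ext_expectation :: "'a measure \<Rightarrow> ('a \<Rightarrow> ereal) \<Rightarrow> ereal" where
  "ext_expectation M f =
     enn2ereal (\<integral>\<^sup>+ x. e2ennreal (f x) \<partial>M) - enn2ereal (\<integral>\<^sup>+ x. e2ennreal (- f x) \<partial>M)"

lemma ext_expectation_eq_integral:
  fixes f :: "'a \<Rightarrow> real"
  assumes "integrable M f"
  shows "ext_expectation M (\<lambda>x. ereal (f x)) = ereal (integral\<^sup>L M f)"
proof -
  obtain r q where rq: "0 \<le> r" "0 \<le> q" "(\<integral>\<^sup>+ x. ennreal (f x) \<partial>M) = ennreal r"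
      "(\<integral>\<^sup>+ x. ennreal (- f x) \<partial>M) = ennreal q" "integral\<^sup>L M f = r - q"
    using integrableE[OF assms] by metis
  have "e2ennreal (- ereal (f x)) = ennreal (- f x)" for x
    by (simp add: e2ennreal_ereal)
  then show ?thesis
    using rq by (simp add: ext_expectation_def e2ennreal_ereal enn2ereal_ennreal)
qed

(* Natural logarithm, values in the extended reals: the library's KL_divergence is real-valued and
   returns 0 when the integral diverges, so it cannot express finiteness.
   RN_deriv P Q is dQ/dP. *)
definition KL :: "'a measure \<Rightarrow> 'a measure \<Rightarrow> ereal" where
  "KL Q P = (if absolutely_continuous P Q
             then ext_expectation Q (\<lambda>x. eln (RN_deriv P Q x)) else \<infinity>)"

definition e_statistics ::
  "('g, 'm) monoid_scheme \<Rightarrow> ('g \<Rightarrow> 'y::topological_space measure) \<Rightarrow> ('y \<Rightarrow> real) set" where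
  "e_statistics G P =
     {T \<in> borel_measurable borel.
        (\<forall>x. 0 \<le> T x) \<and> (SUP g\<in>carrier G. \<integral>\<^sup>+ x. ennreal (T x) \<partial>P g) \<le> 1}"

definition expected_log :: "'y measure \<Rightarrow> ('y \<Rightarrow> real) \<Rightarrow> ereal" where
  "expected_log M T = ext_expectation M (\<lambda>x. eln (ennreal (T x)))"

definition optimal_expected_log ::
  "('g, 'm) monoid_scheme \<Rightarrow> ('g \<Rightarrow> 'y::topological_space measure) \<Rightarrow>
     ('g \<Rightarrow> 'y measure) \<Rightarrow> 'g \<Rightarrow> ereal" where
  "optimal_expected_log G P Q g = (SUP T\<in>e_statistics G P. expected_log (Q g) T)"

definition maximizes_over :: "'t set \<Rightarrow> ('t \<Rightarrow> ereal) \<Rightarrow> 't \<Rightarrow> bool" where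
  "maximizes_over A f T \<longleftrightarrow> T \<in> A \<and> (\<forall>T'\<in>A. f T' \<le> f T)"

definition GROW ::
  "('g, 'm) monoid_scheme \<Rightarrow> ('g \<Rightarrow> 'y::topological_space measure) \<Rightarrow>
     ('g \<Rightarrow> 'y measure) \<Rightarrow> ('y \<Rightarrow> real) \<Rightarrow> bool" where
  "GROW G P Q = maximizes_over (e_statistics G P) (\<lambda>T. INF g\<in>carrier G. expected_log (Q g) T)"

definition relatively_GROW ::
  "('g, 'm) monoid_scheme \<Rightarrow> ('g \<Rightarrow> 'y::topological_space measure) \<Rightarrow>
     ('g \<Rightarrow> 'y measure) \<Rightarrow> ('y \<Rightarrow> real) \<Rightarrow> bool" where
  "relatively_GROW G P Q = maximizes_over (e_statistics G P)
     (\<lambda>T. INF g\<in>carrier G. expected_log (Q g) T - optimal_expected_log G P Q g)"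

end

theory Submission
  imports Defs
begin

text \<open>
  Translating the data by a group element permutes the e-statistics among themselves: under
  \<open>P g\<close> the statistic \<open>T \<circ> act h\<close> is distributed as \<open>T\<close> is
  under \<open>P (h \<otimes> g)\<close>, so the null constraint, which ranges over the whole orbit of
  parameters, is preserved. The same translation carries the expected logarithm under
  \<open>Q (h \<otimes> g)\<close> to that under \<open>Q g\<close>. The optimum at
  \<open>h \<otimes> g\<close> is therefore at most the optimum at \<open>g\<close>, and since the
  group acts transitively on itself all optima agree
  (\<open>optimal_expected_log_constant_on\<close>).

  The relative objective is thus the absolute one minus a constant, and subtracting a constant does
  not change maximizers, provided that the constant is a real number. It is nonnegative because the
  trivial statistic \<open>1\<close> is an e-statistic. It is finite because of the divergence
  hypothesis: writing \<open>r\<close> for the density of \<open>Q g\<close> with respect to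
  \<open>P h\<close>, the positive part of \<open>ln T = ln r + ln (T / r)\<close> is at most
  \<open>ln\<^sup>+ r + T / r\<close>. The first term has finite expectation under
  \<open>Q g\<close> when the divergence is finite, and the expectation of the second is at most
  the expectation of \<open>T\<close> under \<open>P h\<close>, hence at most \<open>1\<close>
  (\<open>expected_log_le_KL_bound\<close>). This crude bound takes the place of Jensen's
  inequality, as only finiteness matters, and since it bounds the
  positive part alone, no indeterminate difference of infinite integrals can occur.
\<close>

section \<open>Extended logarithms\<close>

lemma measurable_eln [measurable]: "eln \<in> borel_measurable borel"
  unfolding eln_def by measurable

lemma expected_log_distr:
  assumes [measurable]: "f \<in> measurable M borel" "T \<in> borel_measurable borel"
  shows "expected_log (distr M borel f) T = expected_log M (T \<circ> f)"
  unfolding expected_log_def ext_expectation_def by (simp add: nn_integral_distr)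

text \<open>
  The inequality \<open>ln\<^sup>+ t \<le> ln\<^sup>+ r + t / r\<close>, which comes from
  \<open>ln (t / r) \<le> t / r\<close>. With the conventions of extended nonnegative division it also
  holds for the degenerate ratios \<open>r = 0\<close> and \<open>r = \<infinity>\<close>, so that it
  applies to Radon-Nikodym derivatives without exceptional null sets.
\<close>

lemma eln_pos_part_le:
  fixes t :: real and r :: ennreal
  assumes "0 \<le> t"
  shows "e2ennreal (eln (ennreal t)) \<le> e2ennreal (eln r) + ennreal t / r"
proof (cases "t = 0")
  case True
  then show ?thesis by (simp add: eln_def e2ennreal_neg)
next
  case False
  with assms have t: "0 < t" by simp
  show ?thesis
  proof (cases r)
    case top
    then show ?thesis by (simp add: eln_def)
  next
    case (real s)
    show ?thesis
    proof (cases "s = 0")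
      case True
      with real t show ?thesis by (simp add: ennreal_divide_zero)
    next
      case False
      with real have s: "0 < s" by simp
      have "ln t = ln s + ln (t / s)" using s t by (simp add: ln_div)
      also have "\<dots> \<le> max 0 (ln s) + t / s"
        using ln_le_minus_one[of "t / s"] s t by simp
      finally have le: "ln t \<le> max 0 (ln s) + t / s" .
      have "e2ennreal (eln (ennreal t)) = ennreal (ln t)"
        using t by (simp add: eln_def e2ennreal_ereal)
      also have "\<dots> \<le> ennreal (max 0 (ln s) + t / s)"
        by (rule ennreal_leI[OF le])
      also have "\<dots> = ennreal (max 0 (ln s)) + ennreal (t / s)"
        using s t by (intro ennreal_plus) auto
      also have "\<dots> = e2ennreal (eln r) + ennreal t / r"
        using s t real by (simp add: eln_def e2ennreal_ereal divide_ennreal max_def ennreal_neg)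
      finally show ?thesis .
    qed
  qed
qed

section \<open>Finiteness of the optimal expected logarithm\<close>

text \<open>
  Finite divergence forces finite positive part, because a difference
  \<open>\<infinity> - b\<close> of extended reals is never finite.
\<close>

lemma finite_KL_imp_finite_pos_part:
  assumes "\<bar>KL Q P\<bar> \<noteq> \<infinity>"
  shows "absolutely_continuous P Q"
    and "(\<integral>\<^sup>+ x. e2ennreal (eln (RN_deriv P Q x)) \<partial>Q) < \<infinity>"
proof -
  show "absolutely_continuous P Q"
    using assms by (auto simp: KL_def split: if_splits)
  with assms have "\<bar>ext_expectation Q (\<lambda>x. eln (RN_deriv P Q x))\<bar> \<noteq> \<infinity>"
    by (simp add: KL_def)
  then show "(\<integral>\<^sup>+ x. e2ennreal (eln (RN_deriv P Q x)) \<partial>Q) < \<infinity>"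
    unfolding ext_expectation_def
    by (cases "\<integral>\<^sup>+ x. e2ennreal (eln (RN_deriv P Q x)) \<partial>Q") auto
qed

lemma nn_integral_divide_RN_deriv_le:
  assumes "sigma_finite_measure P" "absolutely_continuous P Q" "sets Q = sets P"
    and [measurable]: "f \<in> borel_measurable P"
  shows "(\<integral>\<^sup>+ x. f x / RN_deriv P Q x \<partial>Q) \<le> (\<integral>\<^sup>+ x. f x \<partial>P)"
proof -
  have "Q = density P (RN_deriv P Q)"
    using sigma_finite_measure.density_RN_deriv[OF assms(1-3)] by simp
  then have "(\<integral>\<^sup>+ x. f x / RN_deriv P Q x \<partial>Q) =
      (\<integral>\<^sup>+ x. f x / RN_deriv P Q x \<partial>density P (RN_deriv P Q))"
    by simp
  also have "\<dots> = (\<integral>\<^sup>+ x. RN_deriv P Q x * (f x / RN_deriv P Q x) \<partial>P)"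
    by (rule nn_integral_density) measurable
  also have "\<dots> \<le> (\<integral>\<^sup>+ x. f x \<partial>P)"
  proof (rule nn_integral_mono)
    fix x
    show "RN_deriv P Q x * (f x / RN_deriv P Q x) \<le> f x"
    proof (cases "RN_deriv P Q x = 0 \<or> RN_deriv P Q x = \<infinity>")
      case True
      then show ?thesis by auto
    next
      case False
      then have "f x * RN_deriv P Q x / RN_deriv P Q x = f x"
        by (intro ennreal_mult_divide_eq) auto
      then show ?thesis
        by (metis ennreal_times_divide mult.commute order_refl)
    qed
  qed
  finally show ?thesis .
qed

text \<open>
  Dropping the negative part of \<open>ln T\<close> only increases its extended expectation, so the
  pointwise bound on the positive part can simply be integrated.
\<close>

lemma expected_log_le_KL_bound:
  assumes "sigma_finite_measure P" "absolutely_continuous P Q"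
    and sets: "sets P = sets borel" "sets Q = sets borel"
    and [measurable]: "T \<in> borel_measurable borel"
    and T: "\<And>x. 0 \<le> T x" "(\<integral>\<^sup>+ x. ennreal (T x) \<partial>P) \<le> 1"
  shows "expected_log Q T \<le>
    enn2ereal ((\<integral>\<^sup>+ x. e2ennreal (eln (RN_deriv P Q x)) \<partial>Q) + 1)"
proof -
  have meas: "RN_deriv P Q \<in> borel_measurable Q"
    using borel_measurable_RN_deriv[of P Q] sets measurable_cong_sets[of P Q borel borel] by simp
  have [measurable]: "T \<in> borel_measurable P" "T \<in> borel_measurable Q"
    using assms(5) sets measurable_cong_sets[of P borel borel borel]
      measurable_cong_sets[of Q borel borel borel] by auto
  note meas [measurable]
  have "(\<integral>\<^sup>+ x. e2ennreal (eln (ennreal (T x))) \<partial>Q) \<le>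
      (\<integral>\<^sup>+ x. e2ennreal (eln (RN_deriv P Q x)) + ennreal (T x) / RN_deriv P Q x \<partial>Q)"
    by (intro nn_integral_mono eln_pos_part_le T)
  also have "\<dots> = (\<integral>\<^sup>+ x. e2ennreal (eln (RN_deriv P Q x)) \<partial>Q)
      + (\<integral>\<^sup>+ x. ennreal (T x) / RN_deriv P Q x \<partial>Q)"
    by (rule nn_integral_add) measurable
  also have "\<dots> \<le> (\<integral>\<^sup>+ x. e2ennreal (eln (RN_deriv P Q x)) \<partial>Q) + 1"
  proof (rule add_left_mono)
    have "(\<integral>\<^sup>+ x. ennreal (T x) / RN_deriv P Q x \<partial>Q) \<le> (\<integral>\<^sup>+ x. ennreal (T x) \<partial>P)"
      by (rule nn_integral_divide_RN_deriv_le) (use assms in auto)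
    with T(2) show "(\<integral>\<^sup>+ x. ennreal (T x) / RN_deriv P Q x \<partial>Q) \<le> 1"
      by (rule order_trans[rotated])
  qed
  finally have *: "enn2ereal (\<integral>\<^sup>+ x. e2ennreal (eln (ennreal (T x))) \<partial>Q) \<le>
      enn2ereal ((\<integral>\<^sup>+ x. e2ennreal (eln (RN_deriv P Q x)) \<partial>Q) + 1)"
    by (simp add: less_eq_ennreal.rep_eq)
  have drop: "A - enn2ereal B \<le> A" for A B
    by (cases A; cases B) (auto simp: enn2ereal_ennreal)
  show ?thesis
    unfolding expected_log_def ext_expectation_def by (rule order_trans[OF drop *])
qed

lemma optimal_expected_log_less_infinity:
  assumes h: "h \<in> carrier G"
    and P: "prob_space (P h)" "sets (P h) = sets borel" and Q: "sets (Q g) = sets borel"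
    and KL: "\<bar>KL (Q g) (P h)\<bar> \<noteq> \<infinity>"
  shows "optimal_expected_log G P Q g < \<infinity>"
proof -
  define K where "K = (\<integral>\<^sup>+ x. e2ennreal (eln (RN_deriv (P h) (Q g) x)) \<partial>Q g)"
  have sf: "sigma_finite_measure (P h)"
    using P(1) by (simp add: prob_space_imp_sigma_finite)
  have "optimal_expected_log G P Q g \<le> enn2ereal (K + 1)"
    unfolding optimal_expected_log_def
  proof (rule SUP_least)
    fix T assume "T \<in> e_statistics G P"
    then have T: "T \<in> borel_measurable borel" "\<And>x. 0 \<le> T x"
      "(\<integral>\<^sup>+ x. ennreal (T x) \<partial>P h) \<le> 1"
      using h by (auto simp: e_statistics_def SUP_le_iff)
    show "expected_log (Q g) T \<le> enn2ereal (K + 1)"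
      unfolding K_def
      by (rule expected_log_le_KL_bound[OF sf finite_KL_imp_finite_pos_part(1)[OF KL] P(2) Q T])
  qed
  also have "enn2ereal (K + 1) < \<infinity>"
    using finite_KL_imp_finite_pos_part(2)[OF KL]
    by (cases K) (auto simp: K_def[symmetric] enn2ereal_ennreal plus_ennreal.rep_eq)
  finally show ?thesis .
qed

lemma optimal_expected_log_nonneg:
  assumes "\<And>g. g \<in> carrier G \<Longrightarrow> prob_space (P g)"
  shows "0 \<le> optimal_expected_log G P Q g"
proof -
  have "(\<lambda>_. 1) \<in> e_statistics G P"
    using assms by (auto simp: e_statistics_def SUP_le_iff prob_space.emeasure_space_1)
  moreover have "expected_log (Q g) (\<lambda>_. 1) = 0"
    by (simp add: expected_log_def ext_expectation_def eln_def e2ennreal_ereal)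
  ultimately show ?thesis
    unfolding optimal_expected_log_def by (metis SUP_upper)
qed

section \<open>Translation of the data\<close>

lemma group_action_componentwise:
  assumes "group_action G UNIV a"
  shows "group_action G UNIV (componentwise a :: 'g \<Rightarrow> 'x ^ 'n \<Rightarrow> 'x ^ 'n)"
proof -
  interpret group_action G UNIV a by fact
  have G: "group G" using group_hom by (simp add: group_hom_def)
  have one: "componentwise a \<one>\<^bsub>G\<^esub> x = x" for x :: "'x ^ 'n"
    using id_eq_one by (simp add: componentwise_def vec_eq_iff fun_eq_iff)
  have mult: "componentwise a (g \<otimes>\<^bsub>G\<^esub> h) x = componentwise a g (componentwise a h x)"
    if "g \<in> carrier G" "h \<in> carrier G" for g h and x :: "'x ^ 'n"
    using that composition_rule by (simp add: componentwise_def vec_eq_iff)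
  have bij: "bij (componentwise a g :: 'x ^ 'n \<Rightarrow> _)" if g: "g \<in> carrier G" for g
  proof (rule o_bij)
    show "componentwise a g \<circ> componentwise a (inv\<^bsub>G\<^esub> g) = (id :: 'x ^ 'n \<Rightarrow> _)"
      and "componentwise a (inv\<^bsub>G\<^esub> g) \<circ> componentwise a g = (id :: 'x ^ 'n \<Rightarrow> _)"
      using g G
      by (auto simp: fun_eq_iff one mult[symmetric] group.inv_closed group.l_inv group.r_inv)
  qed
  have "componentwise a \<in> hom G (BijGroup (UNIV :: ('x ^ 'n) set))"
  proof (rule homI)
    show "componentwise a g \<in> carrier (BijGroup (UNIV :: ('x ^ 'n) set))" if "g \<in> carrier G" for g
      using bij[OF that] by (simp add: BijGroup_def Bij_def)
    then show "componentwise a (g \<otimes>\<^bsub>G\<^esub> h) =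
        componentwise a g \<otimes>\<^bsub>BijGroup (UNIV :: ('x ^ 'n) set)\<^esub> componentwise a h"
      if "g \<in> carrier G" "h \<in> carrier G" for g h
      using that mult by (simp add: BijGroup_def compose_def fun_eq_iff)
  qed
  then show ?thesis
    unfolding group_action_def group_hom_def group_hom_axioms_def
    using G group_BijGroup by blast
qed

text \<open>
  Invariance of a model is stated for images of measurable sets. As \<open>act h\<close> is onto,
  every measurable set is the image of its preimage, which is again measurable, so invariance
  determines the pushforward.
\<close>

lemma invariant_model_distr:
  assumes act: "group_action G UNIV act"
    and meas: "act h \<in> measurable borel borel"
    and inv: "invariant_model G act P"
    and sets: "sets (P g) = sets borel" "sets (P (h \<otimes>\<^bsub>G\<^esub> g)) = sets borel"
    and g: "g \<in> carrier G" and h: "h \<in> carrier G"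
  shows "distr (P g) borel (act h) = P (h \<otimes>\<^bsub>G\<^esub> g)"
proof (rule measure_eqI)
  have space: "space (P g) = UNIV"
    using sets_eq_imp_space_eq[OF sets(1)] by simp
  have meas': "act h \<in> measurable (P g) borel"
    using meas sets(1) measurable_cong_sets[of "P g" borel borel borel] by auto
  show "sets (distr (P g) borel (act h)) = sets (P (h \<otimes>\<^bsub>G\<^esub> g))"
    using sets by simp
  fix B assume "B \<in> sets (distr (P g) borel (act h))"
  then have B: "B \<in> sets borel" by simp
  have pre: "act h -` B \<in> sets borel"
    using measurable_sets[OF meas B] by simp
  have "surj (act h)"
    using group_action.surj_prop[OF act h] by simp
  then have "act h ` (act h -` B) = B"
    by (simp add: surj_image_vimage_eq)
  moreover have "emeasure (P (h \<otimes>\<^bsub>G\<^esub> g)) (act h ` (act h -` B)) = emeasure (P g) (act h -` B)"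
    using inv g h pre unfolding invariant_model_def by blast
  ultimately show "emeasure (distr (P g) borel (act h)) B = emeasure (P (h \<otimes>\<^bsub>G\<^esub> g)) B"
    using B meas' space by (simp add: emeasure_distr)
qed

text \<open>
  The supremum in the definition of an e-statistic runs over all parameters, and left translation
  maps the parameters to themselves.
\<close>

lemma e_statistics_comp_action:
  assumes act: "group_action G UNIV act"
    and meas: "act h \<in> measurable borel borel"
    and inv: "invariant_model G act P"
    and sets: "\<And>g. g \<in> carrier G \<Longrightarrow> sets (P g) = sets borel"
    and h: "h \<in> carrier G" and T: "T \<in> e_statistics G P"
  shows "T \<circ> act h \<in> e_statistics G P"
proof -
  have G: "group G" using act by (simp add: group_action_def group_hom_def)
  have [measurable]: "T \<in> borel_measurable borel" and "\<And>x. 0 \<le> T x"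
    using T by (auto simp: e_statistics_def)
  moreover have "(\<integral>\<^sup>+ x. ennreal (T (act h x)) \<partial>P g) \<le> 1" if g: "g \<in> carrier G" for g
  proof -
    have hg: "h \<otimes>\<^bsub>G\<^esub> g \<in> carrier G"
      using G g h by (simp add: group.is_monoid monoid.m_closed)
    have "act h \<in> measurable (P g) borel"
      using meas sets[OF g] measurable_cong_sets[of "P g" borel borel borel] by auto
    then have "(\<integral>\<^sup>+ x. ennreal (T (act h x)) \<partial>P g) =
        (\<integral>\<^sup>+ x. ennreal (T x) \<partial>distr (P g) borel (act h))"
      by (simp add: nn_integral_distr)
    also have "\<dots> = (\<integral>\<^sup>+ x. ennreal (T x) \<partial>P (h \<otimes>\<^bsub>G\<^esub> g))"
      using invariant_model_distr[where P = P, OF act meas inv sets[OF g] sets[OF hg] g h] by simp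
    also have "\<dots> \<le> 1"
      using T hg by (auto simp: e_statistics_def SUP_le_iff)
    finally show ?thesis .
  qed
  ultimately show ?thesis
    using measurable_comp[OF meas, of T borel] by (auto simp: e_statistics_def SUP_le_iff)
qed

lemma optimal_expected_log_constant_on:
  assumes act: "group_action G UNIV act"
    and meas: "\<And>g. g \<in> carrier G \<Longrightarrow> act g \<in> measurable borel borel"
    and inv: "invariant_model G act P" "invariant_model G act Q"
    and P: "\<And>g. g \<in> carrier G \<Longrightarrow> sets (P g) = sets borel"
    and Q: "\<And>g. g \<in> carrier G \<Longrightarrow> sets (Q g) = sets borel"
  shows "optimal_expected_log G P Q constant_on carrier G"
proof -
  interpret group G using act by (simp add: group_action_def group_hom_def)
  have translate: "optimal_expected_log G P Q (h \<otimes>\<^bsub>G\<^esub> g) \<le> optimal_expected_log G P Q g"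
    if g: "g \<in> carrier G" and h: "h \<in> carrier G" for g h
    unfolding optimal_expected_log_def
  proof (rule SUP_least)
    fix T assume T: "T \<in> e_statistics G P"
    have "act h \<in> measurable (Q g) borel"
      using meas[OF h] Q[OF g] measurable_cong_sets[of "Q g" borel borel borel] by auto
    then have "expected_log (distr (Q g) borel (act h)) T = expected_log (Q g) (T \<circ> act h)"
      using T by (intro expected_log_distr) (auto simp: e_statistics_def)
    moreover have "distr (Q g) borel (act h) = Q (h \<otimes>\<^bsub>G\<^esub> g)"
      using invariant_model_distr[where P = Q, OF act meas[OF h] inv(2)] Q g h by simp
    moreover have "T \<circ> act h \<in> e_statistics G P"
      using e_statistics_comp_action[OF act meas[OF h] inv(1) P h T] by simp
    ultimately show "expected_log (Q (h \<otimes>\<^bsub>G\<^esub> g)) T \<le> (SUP T\<in>e_statistics G P. expected_log (Q g) T)"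
      by (metis SUP_upper)
  qed
  have "optimal_expected_log G P Q g' \<le> optimal_expected_log G P Q g"
    if "g \<in> carrier G" "g' \<in> carrier G" for g g'
    using translate[of g "g' \<otimes>\<^bsub>G\<^esub> inv\<^bsub>G\<^esub> g"] that by (simp add: m_assoc)
  then show ?thesis
    unfolding constant_on_def by (metis order_antisym)
qed

section \<open>Worst-case and relative worst-case optimality\<close>

lemma INF_ereal_minus_real:
  fixes f :: "'i \<Rightarrow> ereal"
  shows "(INF i\<in>I. f i - ereal c) = (INF i\<in>I. f i) - ereal c"
proof (rule antisym)
  have adjoint: "x \<le> y - ereal c \<longleftrightarrow> x + ereal c \<le> y" for x y
    by (cases x; cases y) auto
  show "(INF i\<in>I. f i - ereal c) \<le> (INF i\<in>I. f i) - ereal c"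
    unfolding adjoint
    by (rule INF_greatest, unfold adjoint[symmetric]) (rule INF_lower)
  show "(INF i\<in>I. f i) - ereal c \<le> (INF i\<in>I. f i - ereal c)"
    by (rule INF_greatest) (intro ereal_minus_mono INF_lower order_refl)
qed

text \<open>
  The constant has to be finite: subtracting \<open>\<infinity>\<close> would collapse all finite
  objective values to \<open>-\<infinity>\<close>.
\<close>

lemma GROW_iff_relatively_GROW:
  assumes c: "\<And>g. g \<in> carrier G \<Longrightarrow> optimal_expected_log G P Q g = ereal c"
  shows "GROW G P Q T \<longleftrightarrow> relatively_GROW G P Q T"
proof -
  have "(INF g\<in>carrier G. expected_log (Q g) T - optimal_expected_log G P Q g) =
      (INF g\<in>carrier G. expected_log (Q g) T) - ereal c" for T
    using c by (simp add: INF_ereal_minus_real[symmetric] cong: INF_cong)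
  moreover have "x - ereal c \<le> y - ereal c \<longleftrightarrow> x \<le> y" for x y
    by (cases x; cases y) auto
  ultimately show ?thesis
    unfolding GROW_def relatively_GROW_def maximizes_over_def by simp
qed

theorem theorem4:
  fixes G :: "('g, 'm) monoid_scheme" and \<tau> :: "'g topology"
    and a :: "'g \<Rightarrow> 'x::topological_space \<Rightarrow> 'x"
    and P Q :: "'g \<Rightarrow> ('x ^ 'n) measure"
    and p q :: "'g \<Rightarrow> 'x ^ 'n \<Rightarrow> ennreal"
    and M :: "('x ^ 'n) measure" and chi :: "'g \<Rightarrow> real" and S :: "('x ^ 'n) set"
  assumes "topological_group G \<tau>"
    and "group_action G UNIV a"
    and "\<And>g. g \<in> carrier G \<Longrightarrow> (componentwise a g :: 'x ^ 'n \<Rightarrow> 'x ^ 'n) \<in> measurable borel borel"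
    and "\<And>g. g \<in> carrier G \<Longrightarrow> prob_space (P g) \<and> sets (P g) = sets borel"
    and "\<And>g. g \<in> carrier G \<Longrightarrow> prob_space (Q g) \<and> sets (Q g) = sets borel"
    and "invariant_model G (componentwise a) P"
    and "invariant_model G (componentwise a) Q"
    and "sets M = sets borel"
    and "relatively_left_invariant G (componentwise a) chi M"
    and "\<And>g. g \<in> carrier G \<Longrightarrow> p g \<in> borel_measurable M \<and> P g = density M (p g)"
    and "\<And>g. g \<in> carrier G \<Longrightarrow> q g \<in> borel_measurable M \<and> Q g = density M (q g)"
    and "\<And>g. g \<in> carrier G \<Longrightarrow> {x. 0 < p g x} = S \<and> {x. 0 < q g x} = S"
    and "\<And>g. g \<in> carrier G \<Longrightarrow> \<exists>h\<in>carrier G. \<bar>KL (Q g) (P h)\<bar> \<noteq> \<infinity>"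
  shows "optimal_expected_log G P Q constant_on carrier G \<and>
    (\<forall>T. GROW G P Q T \<longrightarrow> relatively_GROW G P Q T) \<and>
    (\<forall>T. GROW G P Q T \<longleftrightarrow> relatively_GROW G P Q T)"
proof -
  have const: "optimal_expected_log G P Q constant_on carrier G"
    using assms(4,5) by (intro optimal_expected_log_constant_on[OF
      group_action_componentwise[OF assms(2)] assms(3) assms(6,7)]) simp_all
  then obtain c where c: "\<And>g. g \<in> carrier G \<Longrightarrow> optimal_expected_log G P Q g = c"
    by (auto simp: constant_on_def)
  have one: "\<one>\<^bsub>G\<^esub> \<in> carrier G"
    using assms(1) by (simp add: topological_group_def group.is_monoid)
  obtain h where h: "h \<in> carrier G" "\<bar>KL (Q \<one>\<^bsub>G\<^esub>) (P h)\<bar> \<noteq> \<infinity>"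
    by (rule bexE[OF assms(13)[OF one]])
  have "c < \<infinity>"
    unfolding c[OF one, symmetric]
    by (rule optimal_expected_log_less_infinity[where P = P and Q = Q and h = h])
      (simp_all add: h assms(4)[OF h(1)] assms(5)[OF one])
  moreover have "0 \<le> c"
    unfolding c[OF one, symmetric] using assms(4) by (intro optimal_expected_log_nonneg) simp
  ultimately obtain r where "c = ereal r"
    by (cases c) auto
  then have "GROW G P Q T \<longleftrightarrow> relatively_GROW G P Q T" for T
    using c by (intro GROW_iff_relatively_GROW[where c = r]) auto
  with const show ?thesis by blast
qed

end
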